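(* Let $a<b$ and let $p,s,q,\omega\in C([a,b])$ be real-valued with $p>0$ and $\omega>0$ on $[a,b]$. Let $\lambda_1,\lambda_2,\lambda_3,\ldots$ be the eigenvalues, listed in increasing order, of the boundary value problem $$-\left(p(x)(y'(x)+s(x)y(x))\right)'+s(x)p(x)(y'(x)+s(x)y(x))+q(x)y(x)=\lambda\,\omega(x)y(x),\qquad y(a)=y(b)=0 .$$ Put $\bar s(x)=\int_a^x s(t)\,\mathrm{d}t$, $\tilde p(x)=p(x)e^{-2\bar s(x)}$ and $\tilde\omega(x)=\omega(x)e^{-2\bar s(x)}$. Suppose $f\in C([a,b])$ satisfies $0<f(x)\le\tilde p(x)$ for all $x\in[a,b]$, and there exists a constant $c>0$ such that $\tilde\omega(x)f(x)<c$ on $[a,b]$. Define $$m:=\min_{x\in[a,b]}\frac{q(x)}{\omega(x)} .$$ Then $$\lambda_n\ \ge\ \frac{n^2\pi^2}{c\left(\displaystyle\int_a^b\frac{1}{f(x)}\,\mathrm{d}x\right)^2}+m,\qquad n=1,2,3,\ldots$$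
   Context: A solution of the differential equation is a differentiable function $y$ on $[a,b]$ such that the quasi-derivative $p(y'+sy)$ is also differentiable on $[a,b]$ and the equation holds at every point. A number $\lambda$ is an eigenvalue if the boundary value problem has a solution $y$ that is not identically zero. The eigenvalues are numbered from $n=1$ in increasing order. *)

theory Defs
  imports "HOL-Analysis.Analysis"
begin

text \<open>
  Coefficients and solutions are total functions of which only the values on \<open>[a,b]\<close> matter;
  derivatives are taken within \<open>[a,b]\<close>, hence are one-sided at the end points.
  Below, \<open>y'\<close> is the derivative of \<open>y\<close> and \<open>D\<close> that of the quasi-derivative \<open>p (y' + s y)\<close>;
  for \<open>a < b\<close> both are uniquely determined on \<open>[a,b]\<close>.
\<close>

definition sl_solution ::
    "real \<Rightarrow> real \<Rightarrow> (real \<Rightarrow> real) \<Rightarrow> (real \<Rightarrow> real) \<Rightarrow> (real \<Rightarrow> real) \<Rightarrow> (real \<Rightarrow> real)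
      \<Rightarrow> real \<Rightarrow> (real \<Rightarrow> real) \<Rightarrow> bool" where
  "sl_solution a b p s q w \<mu> y \<longleftrightarrow>
     (\<exists>y' D.
        (\<forall>x\<in>{a..b}. (y has_real_derivative y' x) (at x within {a..b})) \<and>
        (\<forall>x\<in>{a..b}. ((\<lambda>t. p t * (y' t + s t * y t)) has_real_derivative D x) (at x within {a..b})) \<and>
        (\<forall>x\<in>{a..b}. - D x + s x * p x * (y' x + s x * y x) + q x * y x = \<mu> * w x * y x))"

definition sl_eigenvalue ::
    "real \<Rightarrow> real \<Rightarrow> (real \<Rightarrow> real) \<Rightarrow> (real \<Rightarrow> real) \<Rightarrow> (real \<Rightarrow> real) \<Rightarrow> (real \<Rightarrow> real)
      \<Rightarrow> real \<Rightarrow> bool" where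
  "sl_eigenvalue a b p s q w \<mu> \<longleftrightarrow>
     (\<exists>y. sl_solution a b p s q w \<mu> y \<and> y a = 0 \<and> y b = 0 \<and> (\<exists>x\<in>{a..b}. y x \<noteq> 0))"

definition sbar :: "real \<Rightarrow> (real \<Rightarrow> real) \<Rightarrow> real \<Rightarrow> real" where
  "sbar a s x = integral {a..x} s"

text \<open>\<open>tilde a s p\<close> and \<open>tilde a s \<omega>\<close> are the functions written with a tilde over \<open>p\<close> and \<open>\<omega>\<close>.\<close>

definition tilde :: "real \<Rightarrow> (real \<Rightarrow> real) \<Rightarrow> (real \<Rightarrow> real) \<Rightarrow> real \<Rightarrow> real" where
  "tilde a s g x = g x * exp (- 2 * sbar a s x)"

end

theory Submission
  imports Defs
begin

text \<open>
  Multiplying an eigenfunction \<open>y\<close> by the integrating factor \<open>e\<^bsup>S\<^esup>\<close>, where \<open>S' = s\<close>, removes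
  \<open>s\<close>: the functions \<open>u = e\<^bsup>S\<^esup> y\<close> and \<open>v = e\<^bsup>-S\<^esup> p (y' + s y)\<close> satisfy the Hamiltonian system
  \<open>u' = v / P\<close>, \<open>v' = - Q u\<close>, where \<open>P\<close> is \<open>p\<close> with a tilde and
  \<open>Q = (\<lambda> - q / \<omega>) \<omega>'\<close> with \<open>\<omega>'\<close> standing for \<open>\<omega>\<close> with a tilde. The zeros of \<open>u\<close> and \<open>y\<close> agree.

  The bound comes from counting zeros in two ways. On the one hand, the \<open>Q\<close> of a larger eigenvalue
  is pointwise larger, so between two zeros of an eigenfunction there is a zero of every
  eigenfunction for a larger eigenvalue (\<open>sturm_separation\<close>). As all eigenfunctions vanish at \<open>a\<close>
  and \<open>b\<close>, passing to the next eigenvalue adds a zero, whence an eigenfunction for \<open>\<lambda>\<^sub>n\<close> has zeros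
  \<open>a = z\<^sub>0 < \<dots> < z\<^sub>n = b\<close>.

  On the other hand, zeros cannot be too close. Put \<open>F(x) = \<integral>\<^sub>a\<^sup>x 1/f\<close>. The shifted sines
  \<open>sin (k F(x) + d)\<close> solve the same kind of system with the coefficients \<open>f \<le> P\<close> and \<open>k\<^sup>2 / f\<close>, and
  \<open>k\<^sup>2 / f > Q\<close> for \<open>k\<^sup>2 = c (\<lambda> - m)\<close> because \<open>Q \<le> (\<lambda> - m) \<omega>'\<close> and \<open>\<omega>' f < c\<close>; that \<open>\<lambda> > m\<close>
  follows from the same comparison with small \<open>k\<close>. By Sturm and Picone they oscillate faster
  than \<open>u\<close>, so the zeros satisfy \<open>k (F(z\<^sub>i\<^sub>+\<^sub>1) - F(z\<^sub>i)) \<ge> \<pi>\<close> (\<open>zero_spacing\<close>). Summing over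
  \<open>i < n\<close> gives \<open>k F(b) \<ge> n \<pi>\<close>, and squaring gives the claim.
\<close>

section \<open>Hamiltonian systems\<close>

definition hamiltonian_system ::
    "real \<Rightarrow> real \<Rightarrow> (real \<Rightarrow> real) \<Rightarrow> (real \<Rightarrow> real) \<Rightarrow> (real \<Rightarrow> real) \<Rightarrow> (real \<Rightarrow> real) \<Rightarrow> bool" where
  "hamiltonian_system a b P Q u v \<longleftrightarrow>
     (\<forall>x\<in>{a..b}. (u has_real_derivative v x / P x) (at x within {a..b}) \<and>
                 (v has_real_derivative - (Q x * u x)) (at x within {a..b}))"

lemma hamiltonian_system_subinterval:
  assumes "hamiltonian_system a b P Q u v" "a \<le> \<alpha>" "\<beta> \<le> b"
  shows "hamiltonian_system \<alpha> \<beta> P Q u v"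
proof -
  have "{\<alpha>..\<beta>} \<subseteq> {a..b}" using assms by auto
  then show ?thesis
    using assms(1) unfolding hamiltonian_system_def
    by (meson DERIV_subset subsetD)
qed

lemma hamiltonian_system_scale:
  assumes "hamiltonian_system a b P Q u v"
  shows "hamiltonian_system a b P Q (\<lambda>x. k * u x) (\<lambda>x. k * v x)"
  using assms unfolding hamiltonian_system_def
  by (auto intro!: derivative_eq_intros)

lemma hamiltonian_system_continuous:
  assumes "hamiltonian_system a b P Q u v"
  shows "continuous_on {a..b} u" "continuous_on {a..b} v"
  using assms unfolding hamiltonian_system_def
  by (auto intro: DERIV_continuous_on)

lemma hamiltonian_system_interior:
  assumes "hamiltonian_system a b P Q u v" "a < x" "x < b"
  shows "(u has_real_derivative v x / P x) (at x)" "(v has_real_derivative - (Q x * u x)) (at x)"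
proof -
  have "at x within {a..b} = at x"
    using assms by (intro at_within_interior) (auto simp: interior_atLeastAtMost_real)
  moreover have "x \<in> {a..b}" using assms by auto
  ultimately show "(u has_real_derivative v x / P x) (at x)"
      "(v has_real_derivative - (Q x * u x)) (at x)"
    using assms(1) unfolding hamiltonian_system_def by metis+
qed

lemma derivative_within_Icc_antimono:
  fixes g g' :: "real \<Rightarrow> real"
  assumes "\<And>x. x \<in> {a..b} \<Longrightarrow> (g has_real_derivative g' x) (at x within {a..b})"
    and "\<And>x. x \<in> {a..b} \<Longrightarrow> g' x \<le> 0"
    and "x \<in> {a..b}" "y \<in> {a..b}" "x \<le> y"
  shows "g y \<le> g x"
proof (rule DERIV_nonpos_imp_decreasing_open[OF assms(5)])
  show "continuous_on {x..y} g"
    by (rule continuous_on_subset[OF DERIV_continuous_on[OF assms(1)]]) (use assms in auto)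
  fix t assume t: "x < t" "t < y"
  then have "t \<in> {a..b}" "at t within {a..b} = at t"
    using assms by (auto intro!: at_within_interior simp: interior_atLeastAtMost_real)
  then show "\<exists>d. (g has_real_derivative d) (at t) \<and> d \<le> 0"
    using assms(1)[of t] assms(2)[of t] by auto
qed

lemma derivative_within_Icc_mono:
  fixes g g' :: "real \<Rightarrow> real"
  assumes "\<And>x. x \<in> {a..b} \<Longrightarrow> (g has_real_derivative g' x) (at x within {a..b})"
    and "\<And>x. x \<in> {a..b} \<Longrightarrow> 0 \<le> g' x"
    and "x \<in> {a..b}" "y \<in> {a..b}" "x \<le> y"
  shows "g x \<le> g y"
proof -
  have "- g y \<le> - g x"
    by (rule derivative_within_Icc_antimono[OF DERIV_minus[OF assms(1)] _ assms(3-5)])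
      (use assms(2) in auto)
  then show ?thesis by simp
qed

text \<open>
  Uniqueness for the initial value problem with zero data, by Gronwall's argument: the energy
  \<open>E = u\<^sup>2 + v\<^sup>2\<close> satisfies \<open>\<bar>E'\<bar> \<le> K E\<close>, so \<open>E e\<^bsup>-K x\<^esup>\<close> decreases and \<open>E e\<^bsup>K x\<^esup>\<close> increases, and a
  zero of \<open>E\<close> propagates in both directions.
\<close>
lemma hamiltonian_system_unique:
  assumes H: "hamiltonian_system a b P Q u v"
    and P: "continuous_on {a..b} P" "\<forall>x\<in>{a..b}. P x > 0" and Q: "continuous_on {a..b} Q"
    and x0: "x0 \<in> {a..b}" "u x0 = 0" "v x0 = 0" and x: "x \<in> {a..b}"
  shows "u x = 0"
proof -
  define E where "E = (\<lambda>x. (u x)\<^sup>2 + (v x)\<^sup>2)"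
  define R where "R = (\<lambda>x. 1 / P x - Q x)"
  have "continuous_on {a..b} R"
    unfolding R_def using P Q by (intro continuous_intros) auto
  then have "bounded (R ` {a..b})"
    by (intro compact_imp_bounded compact_continuous_image) auto
  then obtain K where K: "\<And>t. t \<in> {a..b} \<Longrightarrow> \<bar>R t\<bar> \<le> K"
    unfolding bounded_real by blast
  have dE: "(E has_real_derivative 2 * u t * v t * R t) (at t within {a..b})"
    if "t \<in> {a..b}" for t
    using H that P unfolding hamiltonian_system_def E_def R_def
    by (auto intro!: derivative_eq_intros simp: field_simps power2_eq_square)
  have bound: "\<bar>2 * u t * v t * R t\<bar> \<le> K * E t" if "t \<in> {a..b}" for t
  proof -
    have "\<bar>2 * u t * v t\<bar> \<le> E t"
      unfolding E_def using sum_squares_bound[of "\<bar>u t\<bar>" "\<bar>v t\<bar>"] by (simp add: abs_mult)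
    then have "\<bar>2 * u t * v t\<bar> * \<bar>R t\<bar> \<le> E t * K"
      using K[OF that] by (intro mult_mono) auto
    then show ?thesis by (simp add: abs_mult mult.commute)
  qed
  have E0: "E x0 = 0" using x0 by (simp add: E_def)
  have "E x \<le> 0"
  proof (cases "x0 \<le> x")
    case True
    have "E x * exp (- K * x) \<le> E x0 * exp (- K * x0)"
    proof (rule derivative_within_Icc_antimono[OF _ _ x0(1) x True])
      fix t assume t: "t \<in> {a..b}"
      show "((\<lambda>t. E t * exp (- K * t)) has_real_derivative
              (2 * u t * v t * R t - K * E t) * exp (- K * t)) (at t within {a..b})"
        by (auto intro!: derivative_eq_intros dE[OF t] simp: algebra_simps)
      show "(2 * u t * v t * R t - K * E t) * exp (- K * t) \<le> 0"
        using bound[OF t] by (intro mult_nonpos_nonneg) auto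
    qed
    then show ?thesis using E0 by (simp add: mult_le_0_iff)
  next
    case False
    have "- (E x0 * exp (K * x0)) \<le> - (E x * exp (K * x))"
    proof (rule derivative_within_Icc_antimono[OF _ _ x x0(1)])
      fix t assume t: "t \<in> {a..b}"
      show "((\<lambda>t. - (E t * exp (K * t))) has_real_derivative
              - (2 * u t * v t * R t + K * E t) * exp (K * t)) (at t within {a..b})"
        by (auto intro!: derivative_eq_intros dE[OF t] simp: algebra_simps)
      show "- (2 * u t * v t * R t + K * E t) * exp (K * t) \<le> 0"
        using bound[OF t] by (intro mult_nonpos_nonneg) auto
    qed (use False in simp)
    then show ?thesis using E0 by (simp add: mult_le_0_iff)
  qed
  then show ?thesis
    unfolding E_def by (simp add: sum_power2_le_zero_iff)
qed

text \<open>
  A nontrivial solution cannot vanish on a whole subinterval, since there \<open>v = P u'\<close> would vanish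
  as well.
\<close>
lemma nontrivial_solution_nonzero_point:
  assumes H: "hamiltonian_system a b P Q u v"
    and P: "continuous_on {a..b} P" "\<forall>x\<in>{a..b}. P x > 0" and Q: "continuous_on {a..b} Q"
    and nz: "\<exists>x\<in>{a..b}. u x \<noteq> 0"
    and \<alpha>\<beta>: "a \<le> \<alpha>" "\<alpha> < \<beta>" "\<beta> \<le> b"
  shows "\<exists>x\<in>{\<alpha><..<\<beta>}. u x \<noteq> 0"
proof (rule ccontr)
  assume "\<not> ?thesis"
  then have z: "\<And>x. x \<in> {\<alpha><..<\<beta>} \<Longrightarrow> u x = 0" by auto
  define t where "t = (\<alpha> + \<beta>) / 2"
  have t: "t \<in> {\<alpha><..<\<beta>}" using \<alpha>\<beta> by (auto simp: t_def)
  have "((\<lambda>_. 0) has_real_derivative v t / P t) (at t)"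
    by (rule has_field_derivative_transform_within_open
          [OF hamiltonian_system_interior(1)[OF H], where S = "{\<alpha><..<\<beta>}"]) (use t \<alpha>\<beta> z in auto)
  then have "v t / P t = 0" by (rule DERIV_unique) simp
  moreover have "P t > 0" using P(2) t \<alpha>\<beta> by auto
  ultimately have "v t = 0" by simp
  then show False
    using hamiltonian_system_unique[OF H P Q, of t] z[OF t] t \<alpha>\<beta> nz by auto
qed

section \<open>Nodal intervals and comparison\<close>

definition nodal_interval :: "(real \<Rightarrow> real) \<Rightarrow> real \<Rightarrow> real \<Rightarrow> bool" where
  "nodal_interval u \<alpha> \<beta> \<longleftrightarrow> \<alpha> < \<beta> \<and> u \<alpha> = 0 \<and> u \<beta> = 0 \<and> (\<forall>x\<in>{\<alpha><..<\<beta>}. u x \<noteq> 0)"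

text \<open>
  The endpoints are the last zero before and the first zero after a point where \<open>u\<close> does not
  vanish.
\<close>
lemma nodal_interval_exists:
  fixes u :: "real \<Rightarrow> real"
  assumes c: "continuous_on {\<alpha>..\<beta>} u" and "u \<alpha> = 0" "u \<beta> = 0"
    and x: "x \<in> {\<alpha><..<\<beta>}" "u x \<noteq> 0"
  obtains \<alpha>' \<beta>' where "\<alpha> \<le> \<alpha>'" "\<beta>' \<le> \<beta>" "nodal_interval u \<alpha>' \<beta>'"
proof -
  define L where "L = {t \<in> {\<alpha>..x}. u t = 0}"
  define R where "R = {t \<in> {x..\<beta>}. u t = 0}"
  have L: "t \<in> L \<longleftrightarrow> \<alpha> \<le> t \<and> t \<le> x \<and> u t = 0"
    and R: "t \<in> R \<longleftrightarrow> x \<le> t \<and> t \<le> \<beta> \<and> u t = 0" for t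
    by (auto simp: L_def R_def)
  have "closed L" unfolding L_def
    by (rule continuous_closed_preimage_constant) (use c x in \<open>auto intro: continuous_on_subset\<close>)
  moreover have "closed R" unfolding R_def
    by (rule continuous_closed_preimage_constant) (use c x in \<open>auto intro: continuous_on_subset\<close>)
  moreover have "\<alpha> \<in> L" "\<beta> \<in> R" unfolding L_def R_def using assms by auto
  then have "L \<noteq> {}" "R \<noteq> {}" by auto
  moreover have bL: "bdd_above L" and bR: "bdd_below R" unfolding L_def R_def by auto
  ultimately have S: "Sup L \<in> L" "Inf R \<in> R"
    using closed_contains_Sup closed_contains_Inf by metis+
  have nz: "u t \<noteq> 0" if t: "t \<in> {Sup L<..<Inf R}" for t
  proof
    assume "u t = 0"
    then have "t \<in> L \<or> t \<in> R" using L R S t by auto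
    then show False
      using cSup_upper[OF _ bL] cInf_lower[OF _ bR] t by fastforce
  qed
  have S': "\<alpha> \<le> Sup L" "Sup L \<le> x" "u (Sup L) = 0"
      "x \<le> Inf R" "Inf R \<le> \<beta>" "u (Inf R) = 0"
    using L R S by auto
  moreover have "Sup L \<noteq> x" "Inf R \<noteq> x" using S' x by auto
  ultimately have "nodal_interval u (Sup L) (Inf R)"
    using nz unfolding nodal_interval_def by auto
  then show thesis using that S' by blast
qed

lemma nonvanishing_constant_sign:
  fixes u :: "real \<Rightarrow> real"
  assumes c: "continuous_on {\<alpha><..<\<beta>} u" and nz: "\<forall>x\<in>{\<alpha><..<\<beta>}. u x \<noteq> 0"
  obtains \<sigma> where "\<forall>x\<in>{\<alpha><..<\<beta>}. \<sigma> * u x > 0"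
proof -
  have conn: "connected (u ` {\<alpha><..<\<beta>})"
    by (intro connected_continuous_image c) simp
  have "(\<forall>x\<in>{\<alpha><..<\<beta>}. u x > 0) \<or> (\<forall>x\<in>{\<alpha><..<\<beta>}. u x < 0)"
  proof (rule ccontr)
    assume "\<not> ?thesis"
    then obtain x y where xy: "x \<in> {\<alpha><..<\<beta>}" "y \<in> {\<alpha><..<\<beta>}" "u x \<le> 0" "0 \<le> u y"
      by (meson not_le)
    then have "0 \<in> u ` {\<alpha><..<\<beta>}"
      using connectedD_interval[OF conn, of "u x" "u y" 0] by blast
    then show False using nz by force
  qed
  then show thesis using that[of 1] that[of "-1"] by auto
qed

text \<open>
  The Wronskian \<open>W = u V - v U\<close> has \<open>W' = (Q - Q') u U < 0\<close>, while \<open>W \<le> 0\<close> at \<open>\<alpha>\<close> and \<open>W \<ge> 0\<close> at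
  \<open>\<beta>\<close> because \<open>u\<close> enters its positive nodal interval with \<open>v \<ge> 0\<close> and leaves it with \<open>v \<le> 0\<close>.
\<close>
lemma sturm_wronskian_contradiction:
  assumes H: "hamiltonian_system \<alpha> \<beta> P Q u v" and H': "hamiltonian_system \<alpha> \<beta> P Q' U V"
    and P: "\<forall>x\<in>{\<alpha>..\<beta>}. P x > 0" and QQ: "\<forall>x\<in>{\<alpha>..\<beta>}. Q x < Q' x"
    and u: "\<alpha> < \<beta>" "u \<alpha> = 0" "u \<beta> = 0" "\<forall>x\<in>{\<alpha><..<\<beta>}. u x > 0"
    and U: "\<forall>x\<in>{\<alpha><..<\<beta>}. U x > 0"
  shows False
proof -
  have ends: "\<alpha> \<in> {\<alpha>..\<beta>}" "\<beta> \<in> {\<alpha>..\<beta>}" using u by auto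
  note cu = hamiltonian_system_continuous[OF H] and cU = hamiltonian_system_continuous[OF H']
  have "U ` closure {\<alpha><..<\<beta>} \<subseteq> {0..}"
    by (rule image_closure_subset) (use u U cU in \<open>auto simp: less_imp_le\<close>)
  then have U0: "U \<alpha> \<ge> 0" "U \<beta> \<ge> 0" using u ends by (auto simp: image_subset_iff)
  have v\<alpha>: "v \<alpha> \<ge> 0"
  proof (rule ccontr)
    assume "\<not> ?thesis"
    then have "v \<alpha> / P \<alpha> < 0" using P ends by (simp add: divide_less_0_iff)
    moreover have "(u has_real_derivative v \<alpha> / P \<alpha>) (at \<alpha> within {\<alpha>..\<beta>})"
      using H ends unfolding hamiltonian_system_def by blast
    ultimately obtain d where d: "d > 0"
        "\<And>h. h > 0 \<Longrightarrow> \<alpha> + h \<in> {\<alpha>..\<beta>} \<Longrightarrow> h < d \<Longrightarrow> u (\<alpha> + h) < u \<alpha>"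
      using has_real_derivative_neg_dec_right by metis
    define h where "h = min d (\<beta> - \<alpha>) / 2"
    have h: "h > 0" "h < d" "h < \<beta> - \<alpha>" using d u by (auto simp: h_def)
    then have "u (\<alpha> + h) > 0" using u(4) by auto
    moreover have "u (\<alpha> + h) < u \<alpha>" using h by (intro d(2)) auto
    ultimately show False using u(2) by simp
  qed
  have v\<beta>: "v \<beta> \<le> 0"
  proof (rule ccontr)
    assume "\<not> ?thesis"
    then have "v \<beta> / P \<beta> > 0" using P ends by simp
    moreover have "(u has_real_derivative v \<beta> / P \<beta>) (at \<beta> within {\<alpha>..\<beta>})"
      using H ends unfolding hamiltonian_system_def by blast
    ultimately obtain d where d: "d > 0"
        "\<And>h. h > 0 \<Longrightarrow> \<beta> - h \<in> {\<alpha>..\<beta>} \<Longrightarrow> h < d \<Longrightarrow> u (\<beta> - h) < u \<beta>"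
      using has_real_derivative_pos_inc_left by metis
    define h where "h = min d (\<beta> - \<alpha>) / 2"
    have h: "h > 0" "h < d" "h < \<beta> - \<alpha>" using d u by (auto simp: h_def)
    then have "u (\<beta> - h) > 0" using u(4) by auto
    moreover have "u (\<beta> - h) < u \<beta>" using h by (intro d(2)) auto
    ultimately show False using u(3) by simp
  qed
  have "u \<beta> * V \<beta> - v \<beta> * U \<beta> < u \<alpha> * V \<alpha> - v \<alpha> * U \<alpha>"
  proof (rule DERIV_neg_imp_decreasing_open[OF u(1)])
    show "continuous_on {\<alpha>..\<beta>} (\<lambda>x. u x * V x - v x * U x)"
      by (intro continuous_intros cu cU)
    fix x assume x: "\<alpha> < x" "x < \<beta>"
    have "((\<lambda>x. u x * V x - v x * U x) has_real_derivative (Q x - Q' x) * (u x * U x)) (at x)"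
      using hamiltonian_system_interior[OF H x] hamiltonian_system_interior[OF H' x]
      by (auto intro!: derivative_eq_intros simp: algebra_simps)
    moreover have "(Q x - Q' x) * (u x * U x) < 0"
      using QQ u U x by (intro mult_neg_pos) auto
    ultimately show "\<exists>d. ((\<lambda>x. u x * V x - v x * U x) has_real_derivative d) (at x) \<and> d < 0"
      by blast
  qed
  moreover have "v \<beta> * U \<beta> \<le> 0" "v \<alpha> * U \<alpha> \<ge> 0"
    using U0 v\<alpha> v\<beta> by (auto intro: mult_nonpos_nonneg)
  ultimately show False using u by simp
qed

text \<open>
  If \<open>U\<close> had no zero, both functions would have constant signs on the interval; as the systems are
  linear, both signs may be taken positive.
\<close>
lemma sturm_separation:
  assumes H: "hamiltonian_system \<alpha> \<beta> P Q u v" and H': "hamiltonian_system \<alpha> \<beta> P Q' U V"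
    and P: "\<forall>x\<in>{\<alpha>..\<beta>}. P x > 0" and QQ: "\<forall>x\<in>{\<alpha>..\<beta>}. Q x < Q' x"
    and u: "nodal_interval u \<alpha> \<beta>"
  shows "\<exists>x\<in>{\<alpha><..<\<beta>}. U x = 0"
proof (rule ccontr)
  assume "\<not> ?thesis"
  then have "\<forall>x\<in>{\<alpha><..<\<beta>}. U x \<noteq> 0" by blast
  moreover have "continuous_on {\<alpha><..<\<beta>} u" "continuous_on {\<alpha><..<\<beta>} U"
    using hamiltonian_system_continuous(1)[OF H] hamiltonian_system_continuous(1)[OF H']
    by (auto elim: continuous_on_subset)
  ultimately obtain \<sigma> \<tau> where "\<forall>x\<in>{\<alpha><..<\<beta>}. \<sigma> * u x > 0" "\<forall>x\<in>{\<alpha><..<\<beta>}. \<tau> * U x > 0"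
    using nonvanishing_constant_sign u unfolding nodal_interval_def by metis
  then show False
    using sturm_wronskian_contradiction[OF hamiltonian_system_scale[OF H, of \<sigma>]
        hamiltonian_system_scale[OF H', of \<tau>] P QQ] u
    unfolding nodal_interval_def by auto
qed

text \<open>
  Here the two systems may differ in both coefficients, so the Wronskian is replaced by Picone's
  function \<open>u v - V u\<^sup>2 / U\<close>. If \<open>U > 0\<close>, it is defined and vanishes at both ends, but its derivative
  \<open>(Q\<^sub>1 - Q) u\<^sup>2 + (v - V u / U)\<^sup>2 / P + (1 / P\<^sub>1 - 1 / P) (V u / U)\<^sup>2\<close> is positive in between.
\<close>
lemma sturm_picone:
  assumes H: "hamiltonian_system \<alpha> \<beta> P Q u v" and H1: "hamiltonian_system \<alpha> \<beta> P1 Q1 U V"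
    and P: "\<forall>x\<in>{\<alpha>..\<beta>}. 0 < P1 x \<and> P1 x \<le> P x" and QQ: "\<forall>x\<in>{\<alpha>..\<beta>}. Q x < Q1 x"
    and u: "nodal_interval u \<alpha> \<beta>"
  shows "\<exists>x\<in>{\<alpha>..\<beta>}. U x \<le> 0"
proof (rule ccontr)
  assume "\<not> ?thesis"
  then have U: "\<And>x. x \<in> {\<alpha>..\<beta>} \<Longrightarrow> U x > 0" by force
  define G where "G = (\<lambda>x. u x * v x - V x * (u x)\<^sup>2 / U x)"
  have "G \<alpha> < G \<beta>"
  proof (rule DERIV_pos_imp_increasing_open[where f = G])
    show "\<alpha> < \<beta>" using u by (simp add: nodal_interval_def)
    show "continuous_on {\<alpha>..\<beta>} G" unfolding G_def
      using U by (intro continuous_intros hamiltonian_system_continuous[OF H]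
          hamiltonian_system_continuous[OF H1]) force
    fix x assume x: "\<alpha> < x" "x < \<beta>"
    then have x': "x \<in> {\<alpha>..\<beta>}" by simp
    have pos: "U x > 0" "P1 x > 0" "P x > 0" using U[OF x'] P x' by force+
    define r where "r = V x * u x / U x"
    define d where "d = (Q1 x - Q x) * (u x)\<^sup>2 + (v x - r)\<^sup>2 / P x + (1 / P1 x - 1 / P x) * r\<^sup>2"
    have "(G has_real_derivative d) (at x)"
      unfolding G_def d_def r_def
      using hamiltonian_system_interior[OF H x] hamiltonian_system_interior[OF H1 x] pos
      by (auto intro!: derivative_eq_intros simp: field_simps power2_eq_square)
    moreover have "d > 0"
    proof -
      have "(Q1 x - Q x) * (u x)\<^sup>2 > 0"
        using QQ x' u x unfolding nodal_interval_def by (intro mult_pos_pos) auto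
      moreover have "(v x - r)\<^sup>2 / P x \<ge> 0" using pos by simp
      moreover have "(1 / P1 x - 1 / P x) * r\<^sup>2 \<ge> 0"
        using P x' pos by (intro mult_nonneg_nonneg) (auto simp: frac_le)
      ultimately show ?thesis unfolding d_def by linarith
    qed
    ultimately show "\<exists>d. (G has_real_derivative d) (at x) \<and> d > 0" by blast
  qed
  then show False using u by (simp add: G_def nodal_interval_def)
qed

section \<open>Spacing and number of zeros\<close>

text \<open>
  If the estimate failed, a phase \<open>\<delta>\<close> could be chosen so that \<open>sin (k (F x - F \<alpha>) + \<delta>)\<close> stays
  positive on the closed nodal interval, against \<open>sturm_picone\<close>.
\<close>
lemma nodal_interval_length:
  assumes H: "hamiltonian_system \<alpha> \<beta> P Q u v"
    and F: "\<And>x. x \<in> {\<alpha>..\<beta>} \<Longrightarrow> (F has_real_derivative 1 / f x) (at x within {\<alpha>..\<beta>})"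
    and f: "\<forall>x\<in>{\<alpha>..\<beta>}. 0 < f x \<and> f x \<le> P x"
    and k: "k > 0" "\<forall>x\<in>{\<alpha>..\<beta>}. Q x < k\<^sup>2 / f x"
    and u: "nodal_interval u \<alpha> \<beta>"
  shows "pi \<le> k * (F \<beta> - F \<alpha>)"
proof (rule ccontr)
  assume "\<not> ?thesis"
  then have lt: "k * (F \<beta> - F \<alpha>) < pi" by simp
  define \<delta> where "\<delta> = (pi - k * (F \<beta> - F \<alpha>)) / 2"
  define \<phi> where "\<phi> = (\<lambda>x. k * (F x - F \<alpha>) + \<delta>)"
  have "hamiltonian_system \<alpha> \<beta> f (\<lambda>x. k\<^sup>2 / f x) (\<lambda>x. sin (\<phi> x)) (\<lambda>x. k * cos (\<phi> x))"
    unfolding hamiltonian_system_def \<phi>_def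
    by (auto intro!: derivative_eq_intros F simp: power2_eq_square)
  then obtain x where x: "x \<in> {\<alpha>..\<beta>}" "sin (\<phi> x) \<le> 0"
    using sturm_picone[OF H _ f k(2) u] by blast
  note mono = derivative_within_Icc_mono[OF F]
  have "F \<alpha> \<le> F x" "F x \<le> F \<beta>" using f x(1) by (auto intro!: mono simp: less_imp_le)
  then have "0 \<le> k * (F x - F \<alpha>)" "k * (F x - F \<alpha>) \<le> k * (F \<beta> - F \<alpha>)" using k by auto
  then have "0 < \<phi> x" "\<phi> x < pi" using lt unfolding \<phi>_def \<delta>_def by (auto simp: field_simps)
  then show False using sin_gt_zero[of "\<phi> x"] x by simp
qed

lemma zero_spacing:
  assumes H: "hamiltonian_system a b P Q u v"
    and P: "continuous_on {a..b} P" and Q: "continuous_on {a..b} Q"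
    and nz: "\<exists>x\<in>{a..b}. u x \<noteq> 0"
    and F: "\<And>x. x \<in> {a..b} \<Longrightarrow> (F has_real_derivative 1 / f x) (at x within {a..b})"
    and f: "\<forall>x\<in>{a..b}. 0 < f x \<and> f x \<le> P x"
    and k: "k > 0" "\<forall>x\<in>{a..b}. Q x < k\<^sup>2 / f x"
    and z: "a \<le> \<alpha>" "\<alpha> < \<beta>" "\<beta> \<le> b" "u \<alpha> = 0" "u \<beta> = 0"
  shows "pi \<le> k * (F \<beta> - F \<alpha>)"
proof -
  have Ppos: "\<forall>x\<in>{a..b}. P x > 0" using f by force
  obtain x where x: "x \<in> {\<alpha><..<\<beta>}" "u x \<noteq> 0"
    using nontrivial_solution_nonzero_point[OF H P Ppos Q nz z(1-3)] by blast
  have "continuous_on {\<alpha>..\<beta>} u"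
    by (rule continuous_on_subset[OF hamiltonian_system_continuous(1)[OF H]]) (use z in auto)
  then obtain \<alpha>' \<beta>' where n: "\<alpha> \<le> \<alpha>'" "\<beta>' \<le> \<beta>" "nodal_interval u \<alpha>' \<beta>'"
    using nodal_interval_exists z x by metis
  have lt: "\<alpha>' < \<beta>'" using n by (simp add: nodal_interval_def)
  have sub: "{\<alpha>'..\<beta>'} \<subseteq> {a..b}" using n z by auto
  have "pi \<le> k * (F \<beta>' - F \<alpha>')"
  proof (rule nodal_interval_length[OF _ _ _ k(1) _ n(3)])
    show "hamiltonian_system \<alpha>' \<beta>' P Q u v"
      by (rule hamiltonian_system_subinterval[OF H]) (use n z in auto)
    show "(F has_real_derivative 1 / f x) (at x within {\<alpha>'..\<beta>'})" if "x \<in> {\<alpha>'..\<beta>'}" for x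
      using F sub that by (meson DERIV_subset subsetD)
  qed (use f k sub in auto)
  moreover have "F \<alpha> \<le> F \<alpha>'" "F \<beta>' \<le> F \<beta>"
    using f n z lt by (auto intro!: derivative_within_Icc_mono[OF F] simp: less_imp_le)
  then have "k * (F \<beta>' - F \<alpha>') \<le> k * (F \<beta> - F \<alpha>)" using k by auto
  ultimately show ?thesis by linarith
qed

lemma chain_mono:
  fixes z :: "nat \<Rightarrow> real"
  assumes "\<forall>i<n. z i < z (Suc i)" "i \<le> j" "j \<le> n"
  shows "z i \<le> z j"
  using assms(2,3)
proof (induction j rule: dec_induct)
  case (step m)
  then show ?case using assms(1)[rule_format, of m] by simp
qed simp

text \<open>
  The new zeros interlace the old ones; together with the common zeros \<open>a\<close> and \<open>b\<close> they are one
  more than before.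
\<close>
lemma zero_count_increases:
  fixes z :: "nat \<Rightarrow> real"
  assumes H: "hamiltonian_system a b P Q u v" and H': "hamiltonian_system a b P Q' U V"
    and P: "continuous_on {a..b} P" "\<forall>x\<in>{a..b}. P x > 0" and Q: "continuous_on {a..b} Q"
    and QQ: "\<forall>x\<in>{a..b}. Q x < Q' x"
    and nz: "\<exists>x\<in>{a..b}. u x \<noteq> 0" and U: "U a = 0" "U b = 0"
    and n: "n \<ge> 1" and z: "z 0 = a" "z n = b" "\<forall>i<n. z i < z (Suc i)" "\<forall>i\<le>n. u (z i) = 0"
  shows "\<exists>w. w 0 = a \<and> w (Suc n) = b \<and> (\<forall>i<Suc n. w i < w (Suc i)) \<and>
             (\<forall>i\<le>Suc n. U (w i) = 0)"
proof -
  note zmono = chain_mono[OF z(3)]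
  have "\<exists>x. x \<in> {z i<..<z (Suc i)} \<and> U x = 0" if i: "i < n" for i
  proof -
    have b: "a \<le> z i" "z i < z (Suc i)" "z (Suc i) \<le> b"
      using zmono[of 0 i] zmono[of "Suc i" n] z i by auto
    obtain x where x: "x \<in> {z i<..<z (Suc i)}" "u x \<noteq> 0"
      using nontrivial_solution_nonzero_point[OF H P Q nz b] by blast
    have "continuous_on {z i..z (Suc i)} u"
      by (rule continuous_on_subset[OF hamiltonian_system_continuous(1)[OF H]]) (use b in auto)
    then obtain \<alpha> \<beta> where nod: "z i \<le> \<alpha>" "\<beta> \<le> z (Suc i)" "nodal_interval u \<alpha> \<beta>"
      using nodal_interval_exists[of "z i" "z (Suc i)" u x] z x i by (metis Suc_leI less_imp_le)
    have sub: "a \<le> \<alpha>" "\<beta> \<le> b" using nod b by auto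
    have "\<exists>x\<in>{\<alpha><..<\<beta>}. U x = 0"
      by (rule sturm_separation[OF hamiltonian_system_subinterval[OF H sub]
            hamiltonian_system_subinterval[OF H' sub] _ _ nod(3)]) (use P QQ sub in auto)
    then show ?thesis using nod by force
  qed
  then obtain g where g: "\<And>i. i < n \<Longrightarrow> g i \<in> {z i<..<z (Suc i)} \<and> U (g i) = 0" by metis
  define w where "w = (\<lambda>i. if i = 0 then a else if i = Suc n then b else g (i - 1))"
  have "w i < w (Suc i)" if "i < Suc n" for i
  proof -
    consider "i = 0" | "i = n" "i \<noteq> 0" | j where "i = Suc j" "Suc j < n"
      using \<open>i < Suc n\<close> by (metis less_antisym not0_implies_Suc)
    then show ?thesis
    proof cases
      case 1
      then show ?thesis using g[of 0] n z by (auto simp: w_def)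
    next
      case 2
      then show ?thesis using g[of "n - 1"] n z by (auto simp: w_def)
    next
      case 3
      then show ?thesis using g[of j] g[of "Suc j"] by (auto simp: w_def)
    qed
  qed
  moreover have "U (w i) = 0" if "i \<le> Suc n" for i
    using that g[of "i - 1"] U by (auto simp: w_def)
  ultimately show ?thesis by (intro exI[of _ w]) (simp add: w_def)
qed

section \<open>Reduction of the eigenvalue problem\<close>

lemma sbar_has_derivative:
  assumes "continuous_on {a..b} s" "x \<in> {a..b}"
  shows "(sbar a s has_real_derivative s x) (at x within {a..b})"
  using integral_has_real_derivative[OF assms] unfolding sbar_def .

lemma tilde_continuous:
  assumes "continuous_on {a..b} s" "continuous_on {a..b} g"
  shows "continuous_on {a..b} (tilde a s g)"
proof -
  have "continuous_on {a..b} (sbar a s)"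
    using DERIV_continuous_on sbar_has_derivative[OF assms(1)] by blast
  then show ?thesis unfolding tilde_def by (intro continuous_intros assms)
qed

lemma sl_solution_imp_hamiltonian_system:
  assumes s: "continuous_on {a..b} s" and p: "\<forall>x\<in>{a..b}. p x > 0"
    and y: "sl_solution a b p s q w \<mu> y"
  shows "\<exists>v. hamiltonian_system a b (tilde a s p) (tilde a s (\<lambda>x. \<mu> * w x - q x))
               (\<lambda>x. exp (sbar a s x) * y x) v"
proof -
  obtain y' D where y':
      "\<And>x. x \<in> {a..b} \<Longrightarrow> (y has_real_derivative y' x) (at x within {a..b})"
    and D: "\<And>x. x \<in> {a..b} \<Longrightarrow>
        ((\<lambda>t. p t * (y' t + s t * y t)) has_real_derivative D x) (at x within {a..b})"
    and eq: "\<And>x. x \<in> {a..b} \<Longrightarrow>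
        - D x + s x * p x * (y' x + s x * y x) + q x * y x = \<mu> * w x * y x"
    using y unfolding sl_solution_def by blast
  define v where "v = (\<lambda>x. exp (- sbar a s x) * (p x * (y' x + s x * y x)))"
  have "((\<lambda>x. exp (sbar a s x) * y x) has_real_derivative v x / tilde a s p x)
          (at x within {a..b})" if x: "x \<in> {a..b}" for x
  proof -
    have "((\<lambda>x. exp (sbar a s x) * y x) has_real_derivative exp (sbar a s x) * (y' x + s x * y x))
          (at x within {a..b})"
      by (auto intro!: derivative_eq_intros y' sbar_has_derivative s x simp: algebra_simps)
    moreover have "p x \<noteq> 0" using p x by force
    then have "exp (sbar a s x) * (y' x + s x * y x) = v x / tilde a s p x"
      by (simp add: v_def tilde_def exp_minus exp_double field_simps power2_eq_square)
    ultimately show ?thesis by simp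
  qed
  moreover have "(v has_real_derivative
      - (tilde a s (\<lambda>x. \<mu> * w x - q x) x * (exp (sbar a s x) * y x))) (at x within {a..b})"
    if x: "x \<in> {a..b}" for x
  proof -
    have "(v has_real_derivative exp (- sbar a s x) * (D x - s x * (p x * (y' x + s x * y x))))
          (at x within {a..b})"
      unfolding v_def
      by (rule DERIV_cong[OF DERIV_mult[OF DERIV_chain2[OF DERIV_exp
                DERIV_minus[OF sbar_has_derivative[OF s x]]] D[OF x]]]) (simp add: algebra_simps)
    moreover have "D x - s x * (p x * (y' x + s x * y x)) = - ((\<mu> * w x - q x) * y x)"
      using eq[OF x] by (simp add: algebra_simps)
    moreover have "exp (- sbar a s x) = exp (- 2 * sbar a s x) * exp (sbar a s x)"
      by (simp flip: exp_add)
    ultimately show ?thesis by (simp add: tilde_def mult_ac)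
  qed
  ultimately show ?thesis unfolding hamiltonian_system_def by blast
qed

lemma sl_eigenvalue_imp_hamiltonian_system:
  assumes "continuous_on {a..b} s" "\<forall>x\<in>{a..b}. p x > 0" "sl_eigenvalue a b p s q w \<mu>"
  obtains u v where
    "hamiltonian_system a b (tilde a s p) (tilde a s (\<lambda>x. \<mu> * w x - q x)) u v"
    "u a = 0" "u b = 0" "\<exists>x\<in>{a..b}. u x \<noteq> 0"
proof -
  obtain y where y: "sl_solution a b p s q w \<mu> y" "y a = 0" "y b = 0" "\<exists>x\<in>{a..b}. y x \<noteq> 0"
    using assms(3) unfolding sl_eigenvalue_def by blast
  then show thesis
    using sl_solution_imp_hamiltonian_system[OF assms(1,2) y(1)] that by fastforce
qed

text \<open>
  The induction runs over all solutions vanishing at \<open>a\<close> and \<open>b\<close> at once, since \<open>zero_count_increases\<close> compares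
  an arbitrary solution for the next eigenvalue with some solution for the present one.
\<close>
lemma eigenfunction_zeros:
  fixes lam :: "nat \<Rightarrow> real"
  assumes ab: "a < b" and p: "continuous_on {a..b} p" "\<forall>x\<in>{a..b}. p x > 0"
    and s: "continuous_on {a..b} s" and q: "continuous_on {a..b} q"
    and w: "continuous_on {a..b} w" "\<forall>x\<in>{a..b}. w x > 0"
    and lam: "strict_mono_on {1..} lam" "\<And>n. n \<ge> 1 \<Longrightarrow> sl_eigenvalue a b p s q w (lam n)"
    and n: "n \<ge> 1"
    and u: "hamiltonian_system a b (tilde a s p) (tilde a s (\<lambda>x. lam n * w x - q x)) u v"
      "u a = 0" "u b = 0"
  shows "\<exists>z. z 0 = a \<and> z n = b \<and> (\<forall>i<n. z i < z (Suc i)) \<and> (\<forall>i\<le>n. u (z i) = 0)"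
  using n u
proof (induction n arbitrary: u v rule: nat_induct_at_least)
  case base
  then show ?case using ab
    by (intro exI[of _ "\<lambda>i. if i = 0 then a else b"]) auto
next
  case (Suc n)
  obtain u0 v0 where u0:
      "hamiltonian_system a b (tilde a s p) (tilde a s (\<lambda>x. lam n * w x - q x)) u0 v0"
      "u0 a = 0" "u0 b = 0" "\<exists>x\<in>{a..b}. u0 x \<noteq> 0"
    using sl_eigenvalue_imp_hamiltonian_system[OF s p(2) lam(2)[OF Suc.hyps]] by blast
  obtain z where z: "z 0 = a" "z n = b" "\<forall>i<n. z i < z (Suc i)" "\<forall>i\<le>n. u0 (z i) = 0"
    using Suc.IH[OF u0(1-3)] by blast
  have "lam n < lam (Suc n)"
    using lam(1) Suc.hyps by (auto intro: strict_mono_onD)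
  then have QQ: "\<forall>x\<in>{a..b}. tilde a s (\<lambda>x. lam n * w x - q x) x
      < tilde a s (\<lambda>x. lam (Suc n) * w x - q x) x"
    using w(2) by (simp add: tilde_def)
  have "continuous_on {a..b} (tilde a s (\<lambda>x. lam n * w x - q x))"
    by (intro tilde_continuous s continuous_intros w q)
  moreover have "\<forall>x\<in>{a..b}. tilde a s p x > 0" using p by (simp add: tilde_def)
  ultimately show ?case
    using zero_count_increases[OF u0(1) Suc.prems(1) tilde_continuous[OF s p(1)] _ _ QQ
        u0(4) Suc.prems(2,3) Suc.hyps z] by blast
qed

theorem theorem3p4:
  fixes a b c :: real
    and p s q \<omega> f :: "real \<Rightarrow> real"
    and lam :: "nat \<Rightarrow> real"
  assumes "a < b"
    and "continuous_on {a..b} p"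
    and "continuous_on {a..b} s"
    and "continuous_on {a..b} q"
    and "continuous_on {a..b} \<omega>"
    and "\<forall>x\<in>{a..b}. p x > 0"
    and "\<forall>x\<in>{a..b}. \<omega> x > 0"
    and "strict_mono_on {1..} lam"
    and "lam ` {1..} = {\<mu>. sl_eigenvalue a b p s q \<omega> \<mu>}"
    and "continuous_on {a..b} f"
    and "\<forall>x\<in>{a..b}. 0 < f x \<and> f x \<le> tilde a s p x"
    and "c > 0"
    and "\<forall>x\<in>{a..b}. tilde a s \<omega> x * f x < c"
  shows "\<forall>n\<ge>1. lam n \<ge> (real n)\<^sup>2 * pi\<^sup>2 / (c * (integral {a..b} (\<lambda>x. 1 / f x))\<^sup>2)
            + (LEAST m. m \<in> (\<lambda>x. q x / \<omega> x) ` {a..b})"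
proof (intro allI impI)
  fix n :: nat assume n: "n \<ge> 1"
  define m where "m = (LEAST m. m \<in> (\<lambda>x. q x / \<omega> x) ` {a..b})"
  define \<Lambda> where "\<Lambda> = lam n"
  define F where "F = (\<lambda>x. integral {a..x} (\<lambda>t. 1 / f t))"
  define Q where "Q = tilde a s (\<lambda>x. \<Lambda> * \<omega> x - q x)"
  have m: "m \<le> q x / \<omega> x" if "x \<in> {a..b}" for x
  proof -
    have "continuous_on {a..b} (\<lambda>x. q x / \<omega> x)"
      using assms(4,5,7) by (intro continuous_intros) force+
    then obtain x0 where x0: "x0 \<in> {a..b}" "\<forall>x\<in>{a..b}. q x0 / \<omega> x0 \<le> q x / \<omega> x"
      using continuous_attains_inf[of "{a..b}" "\<lambda>x. q x / \<omega> x"] assms(1) by auto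
    then have "m = q x0 / \<omega> x0" unfolding m_def by (intro Least_equality) auto
    then show ?thesis using x0 that by simp
  qed
  have fpos: "\<And>x. x \<in> {a..b} \<Longrightarrow> f x > 0" using assms(11) by blast
  have cf: "continuous_on {a..b} (\<lambda>t. 1 / f t)"
    using assms(10) fpos by (intro continuous_intros) force+
  have F: "(F has_real_derivative 1 / f x) (at x within {a..b})" if "x \<in> {a..b}" for x
    unfolding F_def by (rule integral_has_real_derivative[OF cf that])
  have Fa: "F a = 0" by (simp add: F_def)
  have eig: "sl_eigenvalue a b p s q \<omega> (lam k)" if "k \<ge> 1" for k
    using assms(9) that by blast
  obtain u v where u: "hamiltonian_system a b (tilde a s p) Q u v"
      "u a = 0" "u b = 0" "\<exists>x\<in>{a..b}. u x \<noteq> 0"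
    using sl_eigenvalue_imp_hamiltonian_system[OF assms(3,6) eig[OF n]]
    unfolding Q_def \<Lambda>_def by blast
  have cP: "continuous_on {a..b} (tilde a s p)" and cQ: "continuous_on {a..b} Q"
    unfolding Q_def by (intro tilde_continuous continuous_intros assms)+
  note spacing = zero_spacing[OF u(1) cP cQ u(4) F assms(11)]
  have w: "tilde a s \<omega> x > 0" if "x \<in> {a..b}" for x
    using assms(7) that by (simp add: tilde_def)
  have Qle: "Q x \<le> (\<Lambda> - m) * tilde a s \<omega> x" if x: "x \<in> {a..b}" for x
  proof -
    have "m * \<omega> x \<le> q x" using m[OF x] assms(7) x by (simp add: pos_le_divide_eq)
    then have "(\<Lambda> * \<omega> x - q x) * exp (- 2 * sbar a s x)
        \<le> ((\<Lambda> - m) * \<omega> x) * exp (- 2 * sbar a s x)"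
      by (intro mult_right_mono) (auto simp: algebra_simps)
    then show ?thesis by (simp add: Q_def tilde_def mult_ac)
  qed
  have Fb: "F b > 0"
  proof -
    have "F a < F b"
    proof (rule DERIV_pos_imp_increasing_open[OF assms(1)])
      show "continuous_on {a..b} F" using F by (rule DERIV_continuous_on)
      fix x assume "a < x" "x < b"
      then have "at x within {a..b} = at x" "x \<in> {a..b}"
        by (auto intro!: at_within_interior simp: interior_atLeastAtMost_real)
      then show "\<exists>d. (F has_real_derivative d) (at x) \<and> d > 0"
        using F[of x] fpos[of x] by auto
    qed
    then show ?thesis using Fa by simp
  qed
  \<comment> \<open>For \<open>\<Lambda> \<le> m\<close> one has \<open>Q \<le> 0\<close>, so arbitrarily slow sines already oscillate faster than \<open>u\<close>;
      the frequency below is too slow for the two zeros \<open>a\<close> and \<open>b\<close>.\<close>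
  have \<Lambda>m: "\<Lambda> > m"
  proof (rule ccontr)
    assume le: "\<not> \<Lambda> > m"
    define k where "k = pi / (2 * F b)"
    have k: "k > 0" using Fb by (simp add: k_def)
    have "Q x < k\<^sup>2 / f x" if x: "x \<in> {a..b}" for x
    proof -
      have "Q x \<le> 0"
        using Qle[OF x] w[OF x] le mult_nonpos_nonneg[of "\<Lambda> - m" "tilde a s \<omega> x"]
        by linarith
      also have "0 < k\<^sup>2 / f x" using k fpos[OF x] by simp
      finally show ?thesis .
    qed
    then have "pi \<le> k * (F b - F a)"
      using spacing[OF _ k] u(2,3) assms(1) by auto
    then show False using Fa Fb by (simp add: k_def)
  qed
  define k where "k = sqrt (c * (\<Lambda> - m))"
  have k: "k > 0" "k\<^sup>2 = c * (\<Lambda> - m)" using \<Lambda>m assms(12) by (auto simp: k_def)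
  have kQ: "\<forall>x\<in>{a..b}. Q x < k\<^sup>2 / f x"
  proof
    fix x assume x: "x \<in> {a..b}"
    have "tilde a s \<omega> x < c / f x"
      using assms(13) x fpos[OF x] by (simp add: pos_less_divide_eq)
    then have "(\<Lambda> - m) * tilde a s \<omega> x < (\<Lambda> - m) * (c / f x)"
      using \<Lambda>m by (intro mult_strict_left_mono) auto
    then show "Q x < k\<^sup>2 / f x" using Qle[OF x] unfolding k(2) by (simp add: mult_ac)
  qed
  obtain z where z: "z 0 = a" "z n = b" "\<forall>i<n. z i < z (Suc i)" "\<forall>i\<le>n. u (z i) = 0"
    using eigenfunction_zeros[OF assms(1,2,6,3,4,5,7,8) eig n u(1)[unfolded Q_def \<Lambda>_def] u(2,3)]
    by blast
  note zmono = chain_mono[OF z(3)]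
  have "pi \<le> k * (F (z (Suc i)) - F (z i))" if i: "i < n" for i
    using spacing[OF _ k(1) kQ, of "z i" "z (Suc i)"] zmono[of 0 i] zmono[of "Suc i" n] z i by auto
  then have "(\<Sum>i<n. pi) \<le> (\<Sum>i<n. k * (F (z (Suc i)) - F (z i)))"
    by (intro sum_mono) auto
  also have "\<dots> = k * (F (z n) - F (z 0))"
    by (simp add: sum_lessThan_telescope[of "\<lambda>i. F (z i)"] flip: sum_distrib_left)
  finally have "real n * pi \<le> k * F b" using z Fa by simp
  then have "(real n * pi)\<^sup>2 \<le> (k * F b)\<^sup>2" by (intro power_mono) auto
  then have "(real n)\<^sup>2 * pi\<^sup>2 \<le> (\<Lambda> - m) * (c * (F b)\<^sup>2)"
    using k(2) by (simp add: power_mult_distrib mult_ac)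
  then have "(real n)\<^sup>2 * pi\<^sup>2 / (c * (F b)\<^sup>2) \<le> \<Lambda> - m"
    using Fb assms(12) by (simp add: pos_divide_le_eq)
  then show "lam n \<ge> (real n)\<^sup>2 * pi\<^sup>2 / (c * (integral {a..b} (\<lambda>x. 1 / f x))\<^sup>2)
            + (LEAST m. m \<in> (\<lambda>x. q x / \<omega> x) ` {a..b})"
    unfolding \<Lambda>_def m_def F_def by simp
qed

end
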